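(* Let $\mathcal{U}$ be a uniform cover of $U_{\infty}$ such that $\operatorname{diam}(U) < 1$ for each $U\in \mathcal{U}$. Then there is $x\in U_{\infty}$ such that $\mathcal{U}_x = \{U\in\mathcal{U} : x\in U\}$ is infinite.
   Context: $U_{\infty}$ denotes the cube $[0,1]^{\omega}$ (all sequences $x=(x_i)_{i\in\omega}$ with $x_i\in[0,1]$), equipped with the metric given by the $\ell_\infty$-norm, $\|x-y\|_{\ell_\infty}=\sup\{|x_i-y_i| : i\in\omega\}$; diameters are taken in this metric. A uniform cover of a metric space $X$ is a family $\mathcal{U}$ of subsets of $X$ for which there is $\varepsilon>0$ such that for every $x\in X$ the ball $B(x,\varepsilon)$ is contained in some member of $\mathcal{U}$. The family $\mathcal{U}$ is a set of subsets, so $\mathcal{U}_x$ being infinite means that $x$ lies in infinitely many distinct members of $\mathcal{U}$. *)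

theory Defs
  imports "HOL-Analysis.Analysis"
begin

text \<open>
  Since \<open>nat\<close> is discrete, the type \<open>nat \<Rightarrow>\<^sub>C real\<close> of bounded continuous functions is the space of
  all bounded real sequences, and its norm and metric are those of \<open>l\<^sub>\<infinity>\<close>. The two lemmas
  below record this for the cube.
\<close>

definition U_infty :: "(nat \<Rightarrow>\<^sub>C real) set" where
  "U_infty = {x. \<forall>i. apply_bcontfun x i \<in> {0..1}}"

lemma apply_bcontfun_image_U_infty: "apply_bcontfun ` U_infty = {x. \<forall>i. x i \<in> {0..1}}"
proof (intro equalityI subsetI)
  fix x :: "nat \<Rightarrow> real" assume x: "x \<in> {x. \<forall>i. x i \<in> {0..1}}"
  have "bounded (range x)"
    by (rule bounded_subset[of "{0..1}"]) (use x in auto)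
  then have "x \<in> bcontfun"
    by (simp add: bcontfun_def)
  then have "apply_bcontfun (Bcontfun x) = x"
    by (rule Bcontfun_inverse)
  then show "x \<in> apply_bcontfun ` U_infty"
    using x by (intro image_eqI[of _ _ "Bcontfun x"]) (auto simp: U_infty_def)
qed (auto simp: U_infty_def)

lemma dist_seq_eq_SUP:
  fixes x y :: "nat \<Rightarrow>\<^sub>C real"
  shows "dist x y = (SUP i. \<bar>apply_bcontfun x i - apply_bcontfun y i\<bar>)"
  by (simp add: dist_bcontfun_def dist_real_def)

text \<open>\<open>ball x \<epsilon> \<inter> X\<close> is the ball of the metric subspace \<open>X\<close>.\<close>

definition uniform_cover :: "'a::metric_space set \<Rightarrow> 'a set set \<Rightarrow> bool" where
  "uniform_cover X \<U> \<longleftrightarrow>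
     \<U> \<subseteq> Pow X \<and> (\<exists>\<epsilon>>0. \<forall>x\<in>X. \<exists>U\<in>\<U>. ball x \<epsilon> \<inter> X \<subseteq> U)"

end

theory Submission
  imports Defs
begin

text \<open>
  Suppose that every point of the cube lies in only finitely many members of \<open>\<U>\<close>, let
  \<open>\<epsilon>\<close> witness uniformity, and fix \<open>m\<close> with \<open>1 / m < \<epsilon>\<close>. Index the coordinates by pairs \<open>(i, j)\<close>
  of naturals. A list \<open>gs\<close> of \<open>m\<close> functions \<open>nat \<Rightarrow> nat\<close> gives a point of the cube, its
  staircase, whose \<open>(i, j)\<close> entry is the proportion of those \<open>g\<close> in \<open>gs\<close> with \<open>g i \<le> j\<close>. Let
  \<open>f gs\<close> be a member of the cover containing the \<open>\<epsilon>\<close>-ball around this point.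

  If the lists \<open>xs\<close> range over a box \<open>x\<^sub>1 \<le> h\<^sub>1 \<le> x\<^sub>2 \<le> h\<^sub>2 \<le> \<dots> \<le> x\<^sub>m \<le> h\<^sub>m\<close>, every entry of
  the staircase varies by at most \<open>1 / m\<close>. So each point of the box lies in all values of \<open>f\<close> on
  the box, and point-finiteness makes \<open>f\<close> finite on every box. On the other hand, if two lists
  \<open>gs\<close>, \<open>gs'\<close> are such that some row \<open>i\<close> has all \<open>g i\<close> below all \<open>g' i\<close>, then their staircases are
  at distance 1, and as diameters are less than 1, \<open>f\<close> separates them. The contradiction
  comes from a purely combinatorial fact: a function that is finite on every box is constant on a
  set of chains that is large in the iterated sense (many \<open>g\<^sub>1\<close>, for each of them many
  \<open>g\<^sub>2\<close>, and so on), and such a set contains chains arbitrarily steep in one row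
  (\<open>exists_big_fibre\<close>).

  The function \<open>f\<close> comes from arbitrary choices, so no definability is available. What replaces it
  is a second-countability argument. Smallness is a \<open>\<sigma>\<close>-ideal (\<open>small_UN\<close>), and a set of lists is
  described by the countably many patterns it admits. If \<open>f\<close> had no large fibre, discarding
  countably many small sets would leave a function \<open>g'\<close> approximated by a sequence \<open>G n\<close> that
  converges to it in initial segments and in patterns and belongs to pairwise different values
  of \<open>f\<close>. A convergent sequence of functions is bounded pointwise, so all \<open>G n\<close> fit below a single
  \<open>h\<close>; the convergence of patterns allows the same to be repeated in the remaining coordinates
  (\<open>realize_in_box\<close>). This puts infinitely many values of \<open>f\<close> into one box.
\<close>

section \<open>Large sets of functions\<close>

text \<open>
  Unboundedness above the stem \<open>p\<close> in a game-like sense: \<open>H\<close> is a strategy that prescribes a lower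
  bound for the next value in terms of all values so far. With bounds that depend on the position
  alone, \<open>small_UN_nat\<close> would fail: bounds are given separately for every initial segment, and
  those for the infinitely many segments of one length have no common upper bound, whereas a
  strategy sees which segment has occurred.
\<close>

definition large :: "nat list \<Rightarrow> (nat \<Rightarrow> nat) set \<Rightarrow> bool" where
  "large p S \<longleftrightarrow> (\<forall>H :: nat list \<Rightarrow> nat. \<exists>g\<in>S. map g [0..<length p] = p \<and>
     (\<forall>i\<ge>length p. H (map g [0..<i]) \<le> g i))"

definition small :: "(nat \<Rightarrow> nat) set \<Rightarrow> bool" where
  "small S \<longleftrightarrow> (\<forall>p. \<not> large p S)"

lemma large_mono: "large p S \<Longrightarrow> S \<subseteq> T \<Longrightarrow> large p T"
  unfolding large_def by blast

lemma not_largeE: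
  assumes "\<not> large p S"
  obtains H where "\<And>g. g \<in> S \<Longrightarrow> map g [0..<length p] = p \<Longrightarrow>
    \<exists>i\<ge>length p. g i < H (map g [0..<i])"
  using assms by (fastforce simp: large_def not_le)

lemma large_Nil_UNIV: "large [] UNIV"
proof -
  have "\<exists>g. \<forall>i. H (map g [0..<i]) \<le> g i" for H :: "nat list \<Rightarrow> nat"
  proof -
    define s where "s = rec_nat [] (\<lambda>_ s. s @ [H s])"
    have s0: "s 0 = []" and sS: "s (Suc n) = s n @ [H (s n)]" for n
      by (simp_all add: s_def)
    have "map (\<lambda>i. H (s i)) [0..<n] = s n" for n
      by (induction n) (simp_all add: s0 sS)
    then show ?thesis
      by (intro exI[of _ "\<lambda>i. H (s i)"]) simp
  qed
  then show ?thesis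
    unfolding large_def by simp
qed

text \<open>
  One strategy defeats countably many: at \<open>s\<close> it plays the maximum over the finitely many \<open>n\<close> and
  initial segments \<open>q\<close> of \<open>s\<close> that are no longer than \<open>s\<close>. A function that follows it and
  lies in \<open>X n\<close> follows the strategy for \<open>(n, q)\<close> from the end of \<open>q\<close> on, once \<open>q\<close> is long
  enough. This freedom in choosing \<open>q\<close> is why only long \<open>q\<close> need be excluded.
\<close>

lemma small_UN_nat:
  assumes "\<And>n q. L n \<le> length q \<Longrightarrow> \<not> large q (X n)"
  shows "small (\<Union>n::nat. X n)"
  unfolding small_def
proof (intro allI notI)
  fix p assume lp: "large p (\<Union>n. X n)"
  have "\<exists>H. \<forall>g\<in>X n. map g [0..<length q] = q \<longrightarrow> (\<exists>i\<ge>length q. g i < H (map g [0..<i]))"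
    if "L n \<le> length q" for n q
    using not_largeE[OF assms[OF that]] by metis
  then obtain W :: "nat \<Rightarrow> nat list \<Rightarrow> nat list \<Rightarrow> nat" where
    W: "\<And>n q g. L n \<le> length q \<Longrightarrow> g \<in> X n \<Longrightarrow> map g [0..<length q] = q
          \<Longrightarrow> \<exists>i\<ge>length q. g i < W n q (map g [0..<i])"
    by metis
  define H where "H s = Max ((\<lambda>(n, k). W n (take k s) s) ` ({..length s} \<times> {..length s}))" for s
  obtain g where g: "g \<in> (\<Union>n. X n)" "\<And>i. i \<ge> length p \<Longrightarrow> H (map g [0..<i]) \<le> g i"
    using lp unfolding large_def by blast
  then obtain n where n: "g \<in> X n"
    by blast
  define k where "k = max n (max (L n) (length p))"
  define q where "q = map g [0..<k]"
  have "L n \<le> length q" "map g [0..<length q] = q"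
    by (simp_all add: q_def k_def)
  then obtain i where i: "i \<ge> k" "g i < W n q (map g [0..<i])"
    using W[OF _ n, of q] by (metis diff_zero length_map length_upt q_def)
  have "take k (map g [0..<i]) = q"
    using i(1) by (simp add: q_def take_map)
  then have "W n q (map g [0..<i]) \<le> H (map g [0..<i])"
    unfolding H_def using i(1)
    by (intro Max_ge) (auto simp: k_def intro!: image_eqI[of _ _ "(n, k)"])
  also have "\<dots> \<le> g i"
    using g(2) i(1) by (simp add: k_def)
  finally show False
    using i(2) by simp
qed

lemma small_UN:
  assumes "countable I" "\<And>n. n \<in> I \<Longrightarrow> small (X n)"
  shows "small (\<Union>n\<in>I. X n)"
proof (cases "I = {}")
  case True
  then show ?thesis by (simp add: small_def large_def)
next
  case False
  then have "(\<Union>n\<in>I. X n) = (\<Union>n. X (from_nat_into I n))"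
    using assms(1) by (metis UN_extend_simps(10) range_from_nat_into)
  then show ?thesis
    using small_UN_nat[of "\<lambda>_. 0" "\<lambda>n. X (from_nat_into I n)"] assms(2) False
    by (simp add: small_def from_nat_into)
qed

lemma small_subset: "small T \<Longrightarrow> S \<subseteq> T \<Longrightarrow> small S"
  unfolding small_def using large_mono by blast

lemma smallI_long:
  assumes "\<And>q. L \<le> length q \<Longrightarrow> \<not> large q X"
  shows "small X"
  using small_UN_nat[of "\<lambda>_. L" "\<lambda>_. X"] assms by simp

lemma large_Diff_small:
  assumes "large p S" "small X"
  shows "large p (S - X)"
proof (rule ccontr)
  assume "\<not> large p (S - X)"
  then obtain H where H: "\<And>g. g \<in> S - X \<Longrightarrow> map g [0..<length p] = p \<Longrightarrow>
      \<exists>i\<ge>length p. g i < H (map g [0..<i])"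
    using not_largeE by blast
  obtain H' where H': "\<And>g. g \<in> X \<Longrightarrow> map g [0..<length p] = p \<Longrightarrow>
      \<exists>i\<ge>length p. g i < H' (map g [0..<i])"
    using assms(2) not_largeE[of p X] unfolding small_def by blast
  obtain g where g: "g \<in> S" "map g [0..<length p] = p"
      "\<And>i. i \<ge> length p \<Longrightarrow> max (H (map g [0..<i])) (H' (map g [0..<i])) \<le> g i"
    using assms(1)[unfolded large_def, rule_format, of "\<lambda>s. max (H s) (H' s)"] by blast
  then show False
    using H[of g] H'[of g] by (metis DiffI leD max.bounded_iff)
qed

lemma large_above:
  assumes "large p S"
  obtains g where "g \<in> S" "map g [0..<length p] = p" "\<And>i. i \<ge> length p \<Longrightarrow> h i \<le> g i"
  using assms[unfolded large_def, rule_format, of "\<lambda>s. h (length s)"] by auto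

section \<open>Iterated largeness and its countable approximations\<close>

definition slice :: "'a \<Rightarrow> 'a list set \<Rightarrow> 'a list set" where
  "slice g S = {gs. g # gs \<in> S}"

text \<open>
  Patterns are the pieces of information about a set of lists that are used to say when a
  sequence of such sets converges. There are countably many, and a branch mentions only finitely
  many patterns of the slices; this makes it possible to stabilise them on large sets.
\<close>

datatype pattern = Stop | Branch "nat list" "pattern list"

instance pattern :: countable
  by countable_datatype

fun admits :: "(nat \<Rightarrow> nat) list set \<Rightarrow> pattern \<Rightarrow> bool" where
  "admits S Stop \<longleftrightarrow> [] \<in> S"
| "admits S (Branch p as) \<longleftrightarrow> large p {g. \<forall>a\<in>set as. admits (slice g S) a}"

text \<open>
  The iterated quantifier ``for many \<open>g\<^sub>1 \<ge> g\<close> there are many \<open>g\<^sub>2 \<ge> g\<^sub>1\<close> such that \<open>\<dots>\<close>''. The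
  stem \<open>p\<close> at each level may depend on the functions chosen before. It dominates the preceding
  function \<open>g\<close>, so a later lower bound is respected on the rows of the stem if it agrees with \<open>g\<close>
  there.
\<close>

fun big :: "nat \<Rightarrow> (nat \<Rightarrow> nat) \<Rightarrow> (nat \<Rightarrow> nat) list set \<Rightarrow> bool" where
  "big 0 g S \<longleftrightarrow> [] \<in> S"
| "big (Suc j) g S \<longleftrightarrow> (\<exists>p. (\<forall>i<length p. g i \<le> p ! i) \<and>
     large p {g'. g \<le> g' \<and> big j g' (slice g' S)})"

text \<open>
  \<open>interleaved h [g\<^sub>1, g\<^sub>2, \<dots>] [k\<^sub>1, k\<^sub>2, \<dots>]\<close> means \<open>h \<le> g\<^sub>1 \<le> k\<^sub>1 \<le> g\<^sub>2 \<le> k\<^sub>2 \<le> \<dots>\<close>; with \<open>h = 0\<close>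
  the lists interleaved with a fixed \<open>ks\<close> form a box. Every \<open>pre\<close> with \<open>interleaved h pre pre\<close> is a
  chain.
\<close>

fun interleaved :: "'a::order \<Rightarrow> 'a list \<Rightarrow> 'a list \<Rightarrow> bool" where
  "interleaved h [] ks \<longleftrightarrow> ks = []"
| "interleaved h (g # gs) [] \<longleftrightarrow> False"
| "interleaved h (g # gs) (k # ks) \<longleftrightarrow> h \<le> g \<and> g \<le> k \<and> interleaved k gs ks"

lemma interleaved_append:
  assumes "interleaved h0 pre pre"
  shows "interleaved h0 (pre @ xs) (pre @ hs) \<longleftrightarrow> interleaved (last (h0 # pre)) xs hs"
proof -
  have "interleaved h0 pre pre \<longrightarrow>
      interleaved h0 (pre @ xs) (pre @ hs) = interleaved (last (h0 # pre)) xs hs" for h0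
    by (induction pre arbitrary: h0) auto
  then show ?thesis using assms by blast
qed

lemma big_imp_chain:
  assumes "big j g S"
  obtains gs where "gs \<in> S" "length gs = j" "sorted_wrt (\<le>) (g # gs)"
proof -
  have "\<exists>gs\<in>S. length gs = j \<and> sorted_wrt (\<le>) (g # gs)"
    using assms
  proof (induction j arbitrary: g S)
    case 0
    then show ?case by auto
  next
    case (Suc j)
    then obtain p where p: "large p {g'. g \<le> g' \<and> big j g' (slice g' S)}"
      by auto
    obtain g' where g': "g \<le> g'" "big j g' (slice g' S)"
      using large_above[OF p, of "\<lambda>_. 0"] by (metis (mono_tags, lifting) mem_Collect_eq)
    obtain gs where "gs \<in> slice g' S" "length gs = j" "sorted_wrt (\<le>) (g' # gs)"
      using Suc.IH[OF g'(2)] by blast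
    then show ?case
      using g'(1) by (intro bexI[of _ "g' # gs"]) (auto simp: slice_def intro: order_trans)
  qed
  then show ?thesis using that by blast
qed

section \<open>Realizing a convergent sequence of sets inside one box\<close>

text \<open>
  In row \<open>i\<close> only finitely many \<open>G n\<close> differ from \<open>g'\<close>, so the pointwise supremum is finite. Rows
  below \<open>K\<close> are not changed at all, which is what respects a stem of length \<open>K\<close>.
\<close>

lemma convergent_sequence_bounded:
  fixes g' :: "nat \<Rightarrow> nat"
  assumes "\<And>n i. i < n + K \<Longrightarrow> G n i = g' i"
  obtains h where "\<And>n. G n \<le> h" "\<And>i. i < K \<Longrightarrow> h i = g' i"
proof
  define h where "h i = Max (insert (g' i) ((\<lambda>n. G n i) ` {..i}))" for i
  show "G n \<le> h" for n
    unfolding le_fun_def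
  proof
    fix i show "G n i \<le> h i"
      unfolding h_def using assms[of i n] by (intro Max_ge) (cases "n \<le> i"; auto)+
  qed
  show "h i = g' i" if "i < K" for i
  proof -
    have eq: "insert (g' i) ((\<lambda>n. G n i) ` {..i}) = {g' i}"
      using assms that by auto
    show ?thesis unfolding h_def eq by simp
  qed
qed

lemma eventually_diagonal:
  assumes "\<And>n. eventually (P n) sequentially"
  obtains \<rho> :: "nat \<Rightarrow> nat" where "strict_mono \<rho>" "\<And>n. P n (\<rho> n)"
proof -
  obtain N where N: "\<And>n r. r \<ge> N n \<Longrightarrow> P n r"
    using assms unfolding eventually_sequentially by metis
  define \<rho> where "\<rho> n = n + (\<Sum>k\<le>n. N k)" for n
  have "strict_mono \<rho>"
    by (rule strict_mono_Suc_iff[THEN iffD2]) (simp add: \<rho>_def)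
  moreover have "N n \<le> \<rho> n" for n
    unfolding \<rho>_def by (simp add: member_le_sum trans_le_add2)
  ultimately show ?thesis
    using N that by blast
qed

text \<open>
  Up to a small set, every \<open>g\<close> is a limit of functions that share its properties: for each finite
  set \<open>as\<close> of properties of \<open>g\<close>, the set of functions with these properties is large
  above arbitrarily long initial segments of \<open>g\<close>. There are only countably many \<open>as\<close> and
  \<open>n\<close>; for fixed ones, a large set of exceptions would be large above some long stem, and a
  member extending that stem would not be an exception.
\<close>

lemma small_isolated:
  fixes A :: "(nat \<Rightarrow> nat) \<Rightarrow> 'a::countable set"
  shows "small {g. \<exists>as n. set as \<subseteq> A g \<and>
    (\<forall>l\<ge>n. \<not> large (map g [0..<l]) {g'. set as \<subseteq> A g'})}"
proof -
  define X where "X = (\<lambda>(as, n). {g. set as \<subseteq> A g \<and>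
    (\<forall>l\<ge>n. \<not> large (map g [0..<l]) {g'. set as \<subseteq> A g'})})"
  have "small (X (as, n))" for as n
  proof (rule smallI_long[of n])
    fix q :: "nat list" assume q: "n \<le> length q"
    show "\<not> large q (X (as, n))"
    proof
      assume lq: "large q (X (as, n))"
      obtain g where g: "g \<in> X (as, n)" "map g [0..<length q] = q"
        using large_above[OF lq, of "\<lambda>_. 0"] by blast
      have "large q {g'. set as \<subseteq> A g'}"
        using lq by (rule large_mono) (auto simp: X_def)
      then show False
        using g q by (auto simp: X_def)
    qed
  qed
  then have "small (\<Union>c\<in>UNIV. X c)"
    by (intro small_UN) auto
  then show ?thesis
    by (rule small_subset) (auto simp: X_def)
qed

text \<open>
  A sequence of sets \<open>T r\<close> converging to \<open>S\<close> in patterns has a subsequence meeting one box above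
  \<open>h\<close>. Convergence is one-sided: what \<open>S\<close> admits is eventually admitted. The number \<open>K\<close> of
  rows on which \<open>h\<close> has to agree with \<open>g\<close> is independent of \<open>T\<close> and \<open>h\<close>, so that it can be
  respected while \<open>T\<close> and \<open>h\<close> are still being constructed.
\<close>

definition traps :: "nat \<Rightarrow> nat \<Rightarrow> (nat \<Rightarrow> nat) \<Rightarrow> (nat \<Rightarrow> nat) list set \<Rightarrow> bool" where
  "traps j K g S \<longleftrightarrow> (\<forall>T h.
     (\<forall>a. admits S a \<longrightarrow> (\<forall>\<^sub>F r in sequentially. admits (T r) a)) \<longrightarrow>
     (\<forall>i<K. h i = g i) \<longrightarrow>
     (\<exists>\<rho> gs hs. strict_mono (\<rho> :: nat \<Rightarrow> nat) \<and> length hs = j \<and>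
        (\<forall>r. gs r \<in> T (\<rho> r) \<and> interleaved h (gs r) hs)))"

lemma trapsE:
  assumes "traps j K g S"
    and "\<forall>a. admits S a \<longrightarrow> (\<forall>\<^sub>F r in sequentially. admits (T r) a)"
    and "\<forall>i<K. h i = g i"
  obtains \<rho> gs hs where "strict_mono (\<rho> :: nat \<Rightarrow> nat)" "length hs = j"
    "\<And>r. gs r \<in> T (\<rho> r)" "\<And>r. interleaved h (gs r) hs"
proof -
  have "\<exists>\<rho> gs hs. strict_mono (\<rho> :: nat \<Rightarrow> nat) \<and> length hs = j \<and>
      (\<forall>r. gs r \<in> T (\<rho> r) \<and> interleaved h (gs r) hs)"
    using assms(1)[unfolded traps_def, THEN spec, THEN spec, THEN mp, THEN mp, OF assms(2,3)] .
  then show ?thesis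
    using that by blast
qed

text \<open>
  The sets \<open>T r\<close> are treated simultaneously. A typical first entry \<open>g'\<close> for \<open>S\<close> is chosen above
  \<open>h\<close>. Finitely many patterns of its slice are all admitted by the slices at many functions extending
  a long initial segment of \<open>g'\<close>; that is itself a pattern admitted by \<open>S\<close>, hence by \<open>T r\<close> for
  large \<open>r\<close>. This provides first entries \<open>G n\<close> for a subsequence of \<open>T\<close> which converge to \<open>g'\<close> and
  whose slices converge to the slice at \<open>g'\<close>. Their supremum is the next lower bound, and the
  induction hypothesis for the slices supplies the remaining entries.
\<close>

lemma realize_in_box:
  assumes "big j g S"
  shows "\<exists>K. traps j K g S"
  using assms
proof (induction j arbitrary: g S)
  case 0
  show ?case
  proof (rule exI[of _ 0], unfold traps_def, intro allI impI)
    fix T :: "nat \<Rightarrow> (nat \<Rightarrow> nat) list set" and h :: "nat \<Rightarrow> nat"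
    assume "\<forall>a. admits S a \<longrightarrow> (\<forall>\<^sub>F r in sequentially. admits (T r) a)"
    then have "\<forall>\<^sub>F r in sequentially. admits (T r) Stop"
      using 0 by (metis admits.simps(1) big.simps(1))
    then obtain \<rho> :: "nat \<Rightarrow> nat" where "strict_mono \<rho>" "\<And>n. admits (T (\<rho> n)) Stop"
      using eventually_diagonal[of "\<lambda>_ r. admits (T r) Stop"] by blast
    then show "\<exists>\<rho> gs hs. strict_mono (\<rho> :: nat \<Rightarrow> nat) \<and> length hs = 0 \<and>
        (\<forall>r. gs r \<in> T (\<rho> r) \<and> interleaved h (gs r) hs)"
      by (intro exI[of _ \<rho>] exI[of _ "\<lambda>_. []"] exI[of _ "[]"]) simp
  qed
next
  case (Suc j)
  obtain p where p: "\<And>i. i < length p \<Longrightarrow> g i \<le> p ! i"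
      "large p {g'. g \<le> g' \<and> big j g' (slice g' S)}"
    using Suc.prems by auto
  show ?case
  proof (rule exI[of _ "length p"], unfold traps_def, intro allI impI)
    fix T :: "nat \<Rightarrow> (nat \<Rightarrow> nat) list set" and h :: "nat \<Rightarrow> nat"
    assume ev: "\<forall>a. admits S a \<longrightarrow> (\<forall>\<^sub>F r in sequentially. admits (T r) a)"
      and h: "\<forall>i<length p. h i = g i"
    define A where "A g = {a. admits (slice g S) a}" for g
    \<comment> \<open>a first entry that is typical for \<open>S\<close>: its patterns recur along its initial segments\<close>
    obtain g' where g'X: "g' \<in> {g'. g \<le> g' \<and> big j g' (slice g' S)} -
          {g. \<exists>as n. set as \<subseteq> A g \<and> (\<forall>l\<ge>n. \<not> large (map g [0..<l]) {x. set as \<subseteq> A x})}"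
        and g': "map g' [0..<length p] = p" "\<And>i. i \<ge> length p \<Longrightarrow> h i \<le> g' i"
      by (rule large_above[OF large_Diff_small[OF p(2) small_isolated[of A]], of h])
         (rule that; assumption)
    have big': "big j g' (slice g' S)"
      using g'X by simp
    have good: "\<exists>l\<ge>n. large (map g' [0..<l]) {x. set as \<subseteq> A x}" if "set as \<subseteq> A g'" for as n
      using g'X that by simp
    have hg': "h i \<le> g' i" for i
    proof (cases "i < length p")
      case True
      then have "g' i = p ! i"
        using g'(1) by (metis add_0 diff_zero length_upt nth_map nth_upt)
      then show ?thesis using p(1)[OF True] h True by simp
    qed (use g'(2) in auto)
    obtain K where K: "traps j K g' (slice g' S)"
      using Suc.IH[OF big'] ..
    \<comment> \<open>finite sets exhausting the patterns of the slice at \<open>g'\<close>; agreement is asked on \<open>K\<close> more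
      rows, as the next stem may have length \<open>K\<close>\<close>
    define as where "as n = filter (\<lambda>a. a \<in> A g') (map from_nat [0..<n])" for n :: nat
    have "\<exists>l\<ge>n + K. large (map g' [0..<l]) {x. set (as n) \<subseteq> A x}" for n
      by (rule good) (auto simp: as_def)
    then obtain l where l: "\<And>n. l n \<ge> n + K"
        "\<And>n. large (map g' [0..<l n]) {x. set (as n) \<subseteq> A x}"
      by metis
    have "admits S (Branch (map g' [0..<l n]) (as n))" for n
      using l(2)[of n] by (simp add: A_def subset_eq)
    then have "\<forall>\<^sub>F r in sequentially. admits (T r) (Branch (map g' [0..<l n]) (as n))" for n
      using ev by blast
    then obtain \<rho> :: "nat \<Rightarrow> nat" where \<rho>: "strict_mono \<rho>"
        "\<And>n. admits (T (\<rho> n)) (Branch (map g' [0..<l n]) (as n))"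
      using eventually_diagonal[of "\<lambda>n r. admits (T r) (Branch (map g' [0..<l n]) (as n))"]
      by blast
    have "\<exists>x. (\<forall>a\<in>set (as n). admits (slice x (T (\<rho> n))) a) \<and>
        (\<forall>i<l n. x i = g' i) \<and> (\<forall>i\<ge>l n. h i \<le> x i)" for n
    proof -
      have "large (map g' [0..<l n]) {x. \<forall>a\<in>set (as n). admits (slice x (T (\<rho> n))) a}"
        using \<rho>(2)[of n] by simp
      then obtain x where x: "x \<in> {x. \<forall>a\<in>set (as n). admits (slice x (T (\<rho> n))) a}"
          "map x [0..<length (map g' [0..<l n])] = map g' [0..<l n]"
          "\<And>i. i \<ge> length (map g' [0..<l n]) \<Longrightarrow> h i \<le> x i"
        by (rule large_above[of _ _ h]) (rule that; assumption)
      then show ?thesis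
        by (intro exI[of _ x]) simp
    qed
    then have "\<exists>G. \<forall>n. (\<forall>a\<in>set (as n). admits (slice (G n) (T (\<rho> n))) a) \<and>
        (\<forall>i<l n. G n i = g' i) \<and> (\<forall>i\<ge>l n. h i \<le> G n i)"
      by (intro choice allI)
    then obtain G where G: "\<And>n a. a \<in> set (as n) \<Longrightarrow> admits (slice (G n) (T (\<rho> n))) a"
        "\<And>n i. i < l n \<Longrightarrow> G n i = g' i"
        "\<And>n i. i \<ge> l n \<Longrightarrow> h i \<le> G n i"
      by blast
    have hG: "h \<le> G n" for n
    proof (rule le_funI)
      fix i show "h i \<le> G n i"
        using G(2)[of i n] G(3)[of n i] hg'[of i] by (cases "i < l n") auto
    qed
    have agree: "G n i = g' i" if "i < n + K" for n i
      using that l(1)[of n] by (intro G(2)) simp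
    obtain h' where h': "\<And>n. G n \<le> h'" "\<And>i. i < K \<Longrightarrow> h' i = g' i"
      by (rule convergent_sequence_bounded[of K G g', OF agree])
         (assumption | (rule that; assumption))+
    have "\<forall>a. admits (slice g' S) a \<longrightarrow>
        (\<forall>\<^sub>F r in sequentially. admits (slice (G r) (T (\<rho> r))) a)"
    proof (intro allI impI)
      fix a assume a: "admits (slice g' S) a"
      have "a \<in> set (as n)" if "n > to_nat a" for n
        using a that by (auto simp: as_def A_def intro!: image_eqI[of _ _ "to_nat a"])
      then show "\<forall>\<^sub>F r in sequentially. admits (slice (G r) (T (\<rho> r))) a"
        using G(1) by (auto intro: eventually_mono[OF eventually_gt_at_top[of "to_nat a"]])
    qed
    moreover have "\<forall>i<K. h' i = g' i"
      using h'(2) by blast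
    ultimately obtain \<rho>' gs hs where *: "strict_mono (\<rho>' :: nat \<Rightarrow> nat)"
        "length hs = j" "\<And>r. gs r \<in> slice (G (\<rho>' r)) (T (\<rho> (\<rho>' r)))"
        "\<And>r. interleaved h' (gs r) hs"
      by (rule trapsE[OF K]) (rule that; assumption)
    show "\<exists>\<rho> gs hs. strict_mono (\<rho> :: nat \<Rightarrow> nat) \<and> length hs = Suc j \<and>
        (\<forall>r. gs r \<in> T (\<rho> r) \<and> interleaved h (gs r) hs)"
      using * \<rho>(1) hG h'(1)
      by (intro exI[of _ "\<rho> \<circ> \<rho>'"] exI[of _ "\<lambda>r. G (\<rho>' r) # gs r"] exI[of _ "h' # hs"])
         (auto simp: slice_def strict_mono_o)
  qed
qed

section \<open>A function that is finite on boxes has a large fibre\<close>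

lemma distinct_choice:
  assumes "\<And>n::nat. infinite (v ` W n)"
  obtains x where "\<And>n. x n \<in> W n" "inj (\<lambda>n. v (x n))"
proof -
  have "\<exists>F. \<forall>n. (fst (F n) \<in> W n \<and> finite (snd (F n)) \<and> v (fst (F n)) \<in> snd (F n)) \<and>
      snd (F n) \<subseteq> snd (F (Suc n)) \<and> v (fst (F (Suc n))) \<notin> snd (F n)"
  proof (rule dependent_nat_choice)
    obtain y where "y \<in> W 0"
      using assms[of 0] by fastforce
    then show "\<exists>x. fst x \<in> W 0 \<and> finite (snd x) \<and> v (fst x) \<in> snd x"
      by (intro exI[of _ "(y, {v y})"]) simp
  next
    fix x n assume x: "fst x \<in> W n \<and> finite (snd x) \<and> v (fst x) \<in> snd x"
    then obtain w where "w \<in> v ` W (Suc n)" "w \<notin> snd x"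
      using assms[of "Suc n"] by (meson finite_subset subsetI)
    then obtain y where "y \<in> W (Suc n)" "v y \<notin> snd x"
      by blast
    then show "\<exists>y. (fst y \<in> W (Suc n) \<and> finite (snd y) \<and> v (fst y) \<in> snd y) \<and>
        snd x \<subseteq> snd y \<and> v (fst y) \<notin> snd x"
      using x by (intro exI[of _ "(y, insert (v y) (snd x))"]) auto
  qed
  then obtain F where F: "\<And>n. fst (F n) \<in> W n" "\<And>n. v (fst (F n)) \<in> snd (F n)"
      "\<And>n. snd (F n) \<subseteq> snd (F (Suc n))" "\<And>n. v (fst (F (Suc n))) \<notin> snd (F n)"
    by blast
  have mono: "snd (F a) \<subseteq> snd (F b)" if "a \<le> b" for a b
    using lift_Suc_mono_le[of "\<lambda>n. snd (F n)", OF F(3) that] .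
  have "v (fst (F a)) \<noteq> v (fst (F b))" if "a < b" for a b
  proof -
    obtain b' where b': "b = Suc b'" "a \<le> b'"
      using \<open>a < b\<close> by (cases b) auto
    show ?thesis
      using F(2)[of a] F(4)[of b'] mono[OF b'(2)] b'(1) by auto
  qed
  then have "inj (\<lambda>n. v (fst (F n)))"
    by (intro linorder_injI)
  then show ?thesis
    using that[of "\<lambda>n. fst (F n)"] F(1) by blast
qed

text \<open>
  Downward induction on the length of the prefix \<open>pre\<close>. By the induction hypothesis every
  admissible next entry \<open>g\<close> has a value \<open>v g\<close> whose fibre above \<open>g\<close> is large. If no value serves
  for many \<open>g\<close>, then \<open>v\<close> takes infinitely many values on every set, given by an initial segment and
  finitely many patterns, that contains a typical \<open>g'\<close>. So some sequence converging
  to \<open>g'\<close> has distinct values, and \<open>realize_in_box\<close> completes its members to lists in one box.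
\<close>

lemma exists_big_fibre:
  fixes f :: "(nat \<Rightarrow> nat) list \<Rightarrow> 'v"
  assumes fin: "\<And>H. length H = m \<Longrightarrow> finite (f ` {xs. interleaved (\<lambda>_. 0) xs H})"
    and "length pre + j = m" "interleaved (\<lambda>_. 0) pre pre"
  shows "\<exists>v. big j (last ((\<lambda>_. 0) # pre)) {gs. f (pre @ gs) = v}"
  using assms(2,3)
proof (induction j arbitrary: pre)
  case 0
  then show ?case by simp
next
  case (Suc j)
  define g0 where "g0 = last ((\<lambda>_. 0) # pre)"
  have pre: "interleaved (\<lambda>_. 0) (pre @ xs) (pre @ hs) \<longleftrightarrow> interleaved g0 xs hs" for xs hs
    unfolding g0_def by (rule interleaved_append) (use Suc.prems in simp)
  have "\<exists>v. big j g {gs. f (pre @ g # gs) = v}" if "g0 \<le> g" for g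
    using Suc.IH[of "pre @ [g]"] Suc.prems that pre[of "[g]" "[g]"] by simp
  then obtain v where v: "\<And>g. g0 \<le> g \<Longrightarrow> big j g {gs. f (pre @ g # gs) = v g}"
    by metis
  define S where "S g = {gs. f (pre @ g # gs) = v g}" for g
  show ?case
  proof (rule ccontr)
    assume neg: "\<not> ?case"
    have fibre: "small {g. g0 \<le> g \<and> v g = w}" for w
      unfolding small_def
    proof (intro allI notI)
      fix p assume lp: "large p {g. g0 \<le> g \<and> v g = w}"
      have "large p {g. g0 \<le> g \<and> big j g (slice g {gs. f (pre @ gs) = w})}"
        using lp by (rule large_mono) (use v in \<open>auto simp: slice_def\<close>)
      moreover obtain g where g: "g \<in> {g. g0 \<le> g \<and> v g = w}" "map g [0..<length p] = p"
        by (rule large_above[OF lp, of "\<lambda>_. 0"])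
      moreover have "g0 i \<le> p ! i" if "i < length p" for i
      proof -
        have "p ! i = g i"
          using g(2) that by (metis add_0 diff_zero length_upt nth_map nth_upt)
        then show ?thesis using g(1) by (simp add: le_fun_def)
      qed
      ultimately have "big (Suc j) g0 {gs. f (pre @ gs) = w}"
        by auto
      then show False
        using neg unfolding g0_def by blast
    qed
    \<comment> \<open>the countably many finite descriptions of a next entry\<close>
    define W where "W = (\<lambda>(q, as). {g. g0 \<le> g \<and> map g [0..<length q] = q \<and>
        (\<forall>a\<in>set as. admits (S g) a)})"
    have "small (W c)" if "finite (v ` W c)" for c
    proof (rule small_subset)
      show "small (\<Union>w\<in>v ` W c. {g. g0 \<le> g \<and> v g = w})"
        by (rule small_UN) (use that fibre in \<open>auto intro: countable_finite\<close>)
    qed (auto simp: W_def split: prod.splits)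
    then have "small (\<Union>c\<in>{c. finite (v ` W c)}. W c)"
      by (intro small_UN) auto
    then have "large [] (UNIV - (\<Union>c\<in>{c. finite (v ` W c)}. W c))"
      by (rule large_Diff_small[OF large_Nil_UNIV])
    then obtain g' where g'W: "g' \<in> UNIV - (\<Union>c\<in>{c. finite (v ` W c)}. W c)"
        and "\<And>i. i \<ge> length ([] :: nat list) \<Longrightarrow> g0 i \<le> g' i"
      by (rule large_above[of _ _ g0]) (rule that; assumption)
    then have g0: "g0 \<le> g'"
      by (simp add: le_fun_def)
    obtain K where K: "traps j K g' (S g')"
      using realize_in_box[OF v[OF g0]] unfolding S_def ..
    define as where "as n = filter (admits (S g')) (map from_nat [0..<n])" for n :: nat
    define c where "c n = (map g' [0..<n + K], as n)" for n
    have "g' \<in> W (c n)" for n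
      using g0 by (auto simp: W_def c_def as_def)
    then have "infinite (v ` W (c n))" for n
      using g'W by blast
    then obtain G where G: "\<And>n. G n \<in> W (c n)" and inj: "inj (\<lambda>n. v (G n))"
      by (rule distinct_choice) (rule that; assumption)
    have G': "g0 \<le> G n" "map (G n) [0..<n + K] = map g' [0..<n + K]"
        "a \<in> set (as n) \<Longrightarrow> admits (S (G n)) a" for n a
      using G[of n] by (auto simp: W_def c_def)
    have agree: "G n i = g' i" if "i < n + K" for n i
      using G'(2)[of n] that by simp
    obtain h where h: "\<And>n. G n \<le> h" "\<And>i. i < K \<Longrightarrow> h i = g' i"
      by (rule convergent_sequence_bounded[of K G g', OF agree])
         (assumption | (rule that; assumption))+
    have "\<forall>a. admits (S g') a \<longrightarrow> (\<forall>\<^sub>F r in sequentially. admits (S (G r)) a)"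
    proof (intro allI impI)
      fix a assume a: "admits (S g') a"
      have "a \<in> set (as n)" if "n > to_nat a" for n
        using a that by (auto simp: as_def intro!: image_eqI[of _ _ "to_nat a"])
      then show "\<forall>\<^sub>F r in sequentially. admits (S (G r)) a"
        using G'(3) by (auto intro: eventually_mono[OF eventually_gt_at_top[of "to_nat a"]])
    qed
    moreover have "\<forall>i<K. h i = g' i"
      using h(2) by blast
    ultimately obtain \<rho> gs hs where *: "strict_mono (\<rho> :: nat \<Rightarrow> nat)" "length hs = j"
        "\<And>r. gs r \<in> S (G (\<rho> r))" "\<And>r. interleaved h (gs r) hs"
      by (rule trapsE[OF K]) (rule that; assumption)
    have "interleaved (\<lambda>_. 0) (pre @ G (\<rho> r) # gs r) (pre @ h # hs)" for r
      using * h(1) G'(1) by (simp add: pre)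
    moreover have "f (pre @ G (\<rho> r) # gs r) = v (G (\<rho> r))" for r
      using *(3)[of r] by (simp add: S_def)
    ultimately have "range (\<lambda>r. v (G (\<rho> r))) \<subseteq> f ` {xs. interleaved (\<lambda>_. 0) xs (pre @ h # hs)}"
      by (metis (mono_tags, lifting) image_eqI image_subsetI mem_Collect_eq)
    moreover have "finite (f ` {xs. interleaved (\<lambda>_. 0) xs (pre @ h # hs)})"
      using fin Suc.prems *(2) by simp
    ultimately have "finite (range (\<lambda>r. v (G (\<rho> r))))"
      by (rule finite_subset)
    moreover have "inj (\<lambda>r. v (G (\<rho> r)))"
      using inj_compose[OF inj strict_mono_imp_inj_on[OF *(1)]] by (simp add: comp_def)
    ultimately show False
      using finite_imageD by blast
  qed
qed

section \<open>Staircases in the cube\<close>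

lemma interleaved_length: "interleaved h xs H \<Longrightarrow> length xs = length H"
  by (induction h xs H rule: interleaved.induct) auto

text \<open>
  The entry of index \<open>n + 1\<close> lies above the bound of index \<open>n\<close>, so if it counts, that bound
  counts too. Only the first entry has no such partner in the list of bounds, so the counts for
  a list and for its bounds differ by at most one.
\<close>

lemma interleaved_count:
  assumes "interleaved (h :: nat \<Rightarrow> nat) xs H"
  shows "length (filter (\<lambda>g. g i \<le> j) H) \<le> length (filter (\<lambda>g. g i \<le> j) xs)"
    and "length (filter (\<lambda>g. g i \<le> j) xs) \<le> length (filter (\<lambda>g. g i \<le> j) H) + of_bool (h i \<le> j)"
proof -
  have "length (filter (\<lambda>g. g i \<le> j) H) \<le> length (filter (\<lambda>g. g i \<le> j) xs) \<and>
    length (filter (\<lambda>g. g i \<le> j) xs) \<le> length (filter (\<lambda>g. g i \<le> j) H) + of_bool (h i \<le> j)"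
    using assms
  proof (induction h xs H rule: interleaved.induct)
    case (3 h x xs k H)
    then have "h i \<le> x i" "x i \<le> k i" "interleaved k xs H"
      by (auto simp: le_fun_def)
    then show ?case
      using 3(1) by (auto split: if_splits)
  qed auto
  then show "length (filter (\<lambda>g. g i \<le> j) H) \<le> length (filter (\<lambda>g. g i \<le> j) xs)"
    and "length (filter (\<lambda>g. g i \<le> j) xs) \<le> length (filter (\<lambda>g. g i \<le> j) H) + of_bool (h i \<le> j)"
    by auto
qed

lemma bounded_U_infty: "bounded U_infty"
proof -
  have "norm x \<le> 1" if "x \<in> U_infty" for x
    by (rule norm_bound) (use that in \<open>auto simp: U_infty_def abs_le_iff\<close>)
  then show ?thesis
    by (auto simp: bounded_iff)
qed

definition staircase :: "(nat \<Rightarrow> nat) list \<Rightarrow> nat \<Rightarrow> real" where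
  "staircase gs k = (case prod_decode k of (i, j) \<Rightarrow>
     real (length (filter (\<lambda>g. g i \<le> j) gs)) / real (length gs))"

section \<open>Uniform covers by sets of diameter less than one\<close>

theorem theorem5p1:
  fixes \<U> :: "(nat \<Rightarrow>\<^sub>C real) set set"
  assumes "uniform_cover U_infty \<U>"
    and "\<And>U. U \<in> \<U> \<Longrightarrow> diameter U < 1"
  shows "\<exists>x\<in>U_infty. infinite {U \<in> \<U>. x \<in> U}"
proof (rule ccontr)
  assume "\<not> ?thesis"
  then have point_finite: "finite {U \<in> \<U>. x \<in> U}" if "x \<in> U_infty" for x
    using that by blast
  obtain \<epsilon> where \<epsilon>: "\<epsilon> > 0" "\<And>x. x \<in> U_infty \<Longrightarrow> \<exists>U\<in>\<U>. ball x \<epsilon> \<inter> U_infty \<subseteq> U"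
    and sub: "\<U> \<subseteq> Pow U_infty"
    using assms(1) unfolding uniform_cover_def by blast
  obtain m' where m': "inverse (real (Suc m')) < \<epsilon>"
    using reals_Archimedean[OF \<epsilon>(1)] by blast
  define m where "m = Suc m'"
  have m: "m > 0" "1 / real m < \<epsilon>"
    using m' by (simp_all add: m_def inverse_eq_divide)
  have "staircase gs \<in> {x. \<forall>i. x i \<in> {0..1}}" for gs
    by (auto simp: staircase_def divide_le_eq_1 split: prod.splits intro: length_filter_le)
  then have "\<exists>x\<in>U_infty. apply_bcontfun x = staircase gs" for gs
    unfolding apply_bcontfun_image_U_infty[symmetric] by (metis imageE)
  then obtain P where P: "\<And>gs. P gs \<in> U_infty" "\<And>gs. apply_bcontfun (P gs) = staircase gs"
    by metis
  obtain f where f: "\<And>gs. f gs \<in> \<U>" "\<And>gs. ball (P gs) \<epsilon> \<inter> U_infty \<subseteq> f gs"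
    using \<epsilon>(2)[OF P(1)] by metis
  have P_in_f: "P gs \<in> f gs" for gs
    using f(2)[of gs] P(1)[of gs] \<epsilon>(1) by auto
  have "finite (f ` {xs. interleaved (\<lambda>_. 0) xs H})" if H: "length H = m" for H
  proof (cases "{xs. interleaved (\<lambda>_. 0) xs H} = {}")
    case False
    then obtain ys where ys: "interleaved (\<lambda>_. 0) ys H"
      by blast
    have "P ys \<in> f xs" if xs: "interleaved (\<lambda>_. 0) xs H" for xs
    proof -
      have "dist (P xs) (P ys) \<le> 1 / real m"
      proof (rule dist_bound)
        fix k
        obtain i j where k: "prod_decode k = (i, j)"
          by fastforce
        let ?N = "\<lambda>gs. length (filter (\<lambda>g. g i \<le> j) gs)"
        have "\<bar>real (?N xs) - real (?N ys)\<bar> \<le> 1"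
          using interleaved_count[OF xs, of i j] interleaved_count[OF ys, of i j] by simp
        then show "dist (apply_bcontfun (P xs) k) (apply_bcontfun (P ys) k) \<le> 1 / real m"
          using interleaved_length[OF xs] interleaved_length[OF ys] H m(1)
          by (simp add: P(2) staircase_def k dist_real_def divide_right_mono
                flip: diff_divide_distrib)
      qed
      then show ?thesis
        using f(2)[of xs] P(1)[of ys] m(2) by auto
    qed
    then have "f ` {xs. interleaved (\<lambda>_. 0) xs H} \<subseteq> {U \<in> \<U>. P ys \<in> U}"
      using f(1) by blast
    then show ?thesis
      using point_finite[OF P(1)] by (rule finite_subset)
  qed simp
  from exists_big_fibre[of m f "[]", OF this]
  obtain U where "big m (\<lambda>_. 0) {gs. f gs = U}"
    by auto
  then obtain p where p: "large p {g. (\<lambda>_. 0) \<le> g \<and> big m' g (slice g {gs. f gs = U})}"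
    by (auto simp: m_def)
  define i where "i = length p"
  \<comment> \<open>row \<open>i\<close> is the first beyond the stem, so a large set is unbounded there\<close>
  have steep: "\<exists>gs. f gs = U \<and> length gs = m \<and> (\<forall>g\<in>set gs. N \<le> g i)" for N
  proof -
    obtain g where g: "g \<in> {g. (\<lambda>_. 0) \<le> g \<and> big m' g (slice g {gs. f gs = U})}"
        and N: "\<And>i. i \<ge> length p \<Longrightarrow> N \<le> g i"
      by (rule large_above[OF p, of "\<lambda>_. N"]) (rule that; assumption)
    then obtain gs where "gs \<in> slice g {gs. f gs = U}" "length gs = m'"
        "sorted_wrt (\<le>) (g # gs)"
      using big_imp_chain[of m' g] by blast
    then show ?thesis
      using N[of i] by (intro exI[of _ "g # gs"])
        (auto simp: slice_def m_def i_def le_fun_def intro: order_trans)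
  qed
  obtain gs where gs: "f gs = U" "length gs = m"
    using steep[of 0] by blast
  define N where "N = Max (insert 0 ((\<lambda>g. g i) ` set gs))"
  obtain gs' where gs': "f gs' = U" "length gs' = m" "\<And>g. g \<in> set gs' \<Longrightarrow> Suc N \<le> g i"
    using steep[of "Suc N"] by blast
  have "g i \<le> N" if "g \<in> set gs" for g
    unfolding N_def using that by (intro Max_ge) auto
  then have "filter (\<lambda>g. g i \<le> N) gs = gs"
    by (simp add: filter_id_conv)
  moreover have "filter (\<lambda>g. g i \<le> N) gs' = []"
    using gs'(3) by (fastforce simp: filter_empty_conv)
  ultimately have "dist (apply_bcontfun (P gs) (prod_encode (i, N)))
      (apply_bcontfun (P gs') (prod_encode (i, N))) = 1"
    using gs(2) gs'(2) m(1) by (simp add: P(2) staircase_def dist_real_def)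
  then have "1 \<le> dist (P gs) (P gs')"
    using dist_bounded by metis
  also have "\<dots> \<le> diameter U"
  proof (rule diameter_bounded_bound)
    show "bounded U"
      using bounded_U_infty f(1)[of gs] gs(1) sub by (meson PowD bounded_subset subsetD)
  qed (use P_in_f gs(1) gs'(1) in auto)
  finally show False
    using assms(2)[OF f(1)[of gs]] gs(1) by simp
qed

end
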